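(* Let $\Phi$, $\mu$, $j$, $\nu$, $\mathcal J$, $\varphi$, $V$ be as in the standing assumption (see context), and suppose that $\varphi\in\mathcal Z(\mathbb R^d)$, with associated functions $L_\varphi,R_\varphi:\mathbb R^d\to(0,\infty)$. Then for every $x\in\mathbb R^d$ $$V(x)\le \frac{2\|\varphi\|_\infty}{\varphi(x)}\,\nu\big(B^c_{R_\varphi(x)}(0)\big)+\frac{L_\varphi(x)}{2\varphi(x)}\,\mathcal J(R_\varphi(x))<\infty .$$
   Context: Notation: $B_r(a)$ is the open ball in $\mathbb R^d$, $B_r^c(a)$ its complement; $D_hf(x)=f(x+h)-2f(x)+f(x-h)$. $\Phi$ is a complete Bernstein function with Lévy pair $(0,\mu)$: $\Phi(u)=\int_0^\infty(1-e^{-ut})\mu(t)\,dt$ with $\mu:(0,\infty)\to[0,\infty)$ completely monotone and $\int_0^\infty\min(1,t)\mu(t)\,dt<\infty$. The jump kernel is $j(r)=(4\pi)^{-d/2}\int_0^\infty t^{-d/2}e^{-r^2/(4t)}\mu(t)\,dt$, $r>0$; $\nu(dx)=j(|x|)\,dx$ is the corresponding Lévy measure on $\mathbb R^d\setminus\{0\}$, and $\mathcal J(R)=\int_{B_R(0)}|h|^2j(|h|)\,dh$. $\Phi(-\Delta)$ is the operator on $L^2(\mathbb R^d)$ with Fourier multiplier $\Phi(|y|^2)$. Standing assumption: $V:\mathbb R^d\to\mathbb R$ is a potential, $H=\Phi(-\Delta)+V$, and $\varphi\in L^2(\mathbb R^d)\cap L^\infty(\mathbb R^d)$, $\varphi>0$,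 satisfies $H\varphi=0$. The potential is understood through the pointwise expression $V(x)=-\frac{1}{\varphi(x)}\Phi(-\Delta)\varphi(x)=\frac{1}{2\varphi(x)}\int_{\mathbb R^d}D_h\varphi(x)\,j(|h|)\,dh$. Space: for $\Omega\subset\mathbb R^d$, $\mathcal Z(\Omega)$ is the set of $f\in L^\infty(\mathbb R^d)$ for which there exist functions $L_f,R_f:\Omega\to(0,\infty)$ such that $|D_hf(x)|\le L_f(x)|h|^2$ for all $x\in\Omega$ and $h\in B_{R_f(x)}(0)$. *)

theory Defs
  imports "HOL-Probability.Probability"
begin

section \<open>Complete Bernstein functions and the jump kernel\<close>

definition completely_monotone :: "(real \<Rightarrow> real) \<Rightarrow> bool" where
  "completely_monotone \<mu> \<longleftrightarrow>
     (\<forall>n. \<forall>t>0. (deriv ^^ n) \<mu> differentiable (at t) \<and> 0 \<le> (-1) ^ n * (deriv ^^ n) \<mu> t)"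

text \<open>\<open>\<Phi>\<close> and \<open>\<mu>\<close> are functions on \<open>(0,\<infinity>)\<close>; their values elsewhere are irrelevant.\<close>

definition complete_bernstein_pair :: "(real \<Rightarrow> real) \<Rightarrow> (real \<Rightarrow> real) \<Rightarrow> bool" where
  "complete_bernstein_pair \<Phi> \<mu> \<longleftrightarrow>
     completely_monotone \<mu> \<and>
     set_integrable lborel {0<..} (\<lambda>t. min 1 t * \<mu> t) \<and>
     (\<forall>u>0. \<Phi> u = (LINT t:{0<..}|lborel. (1 - exp (- (u * t))) * \<mu> t))"

text \<open>The first argument is the dimension of the space. For a pair as above and \<open>r > 0\<close>
  the integral converges.\<close>

definition jump_kernel :: "nat \<Rightarrow> (real \<Rightarrow> real) \<Rightarrow> real \<Rightarrow> real" where
  "jump_kernel d \<mu> r =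
     (4 * pi) powr (- real d / 2) *
     (LINT t:{0<..}|lborel. t powr (- real d / 2) * exp (- (r\<^sup>2 / (4 * t))) * \<mu> t)"

definition levy_measure :: "(real \<Rightarrow> real) \<Rightarrow> 'a::euclidean_space measure" where
  "levy_measure \<mu> =
     density (restrict_space lborel (UNIV - {0})) (\<lambda>x. ennreal (jump_kernel DIM('a) \<mu> (norm x)))"

definition levy_moment :: "'a::euclidean_space itself \<Rightarrow> (real \<Rightarrow> real) \<Rightarrow> real \<Rightarrow> ennreal" where
  "levy_moment _ \<mu> R =
     (\<integral>\<^sup>+h\<in>ball (0::'a) R. ennreal ((norm h)\<^sup>2 * jump_kernel DIM('a) \<mu> (norm h)) \<partial>lborel)"


section \<open>Function spaces\<close>

definition L1_space :: "('a::euclidean_space \<Rightarrow> 'b::euclidean_space) set" where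
  "L1_space = {f. integrable lebesgue f}"

definition L2_space :: "('a::euclidean_space \<Rightarrow> 'b::euclidean_space) set" where
  "L2_space = {f \<in> borel_measurable lebesgue. integrable lebesgue (\<lambda>x. (norm (f x))\<^sup>2)}"

definition Linf_space :: "('a::euclidean_space \<Rightarrow> 'b::euclidean_space) set" where
  "Linf_space = {f \<in> borel_measurable lebesgue. esssup lebesgue (\<lambda>x. ereal (norm (f x))) < \<infinity>}"

definition Linf_norm :: "('a::euclidean_space \<Rightarrow> 'b::euclidean_space) \<Rightarrow> real" where
  "Linf_norm f = real_of_ereal (esssup lebesgue (\<lambda>x. ereal (norm (f x))))"

definition second_diff :: "('a::euclidean_space \<Rightarrow> real) \<Rightarrow> 'a \<Rightarrow> 'a \<Rightarrow> real" where
  "second_diff f h x = f (x + h) - 2 * f x + f (x - h)"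

text \<open>\<open>L\<close> and \<open>R\<close> are functions associated with \<open>f\<close> in the definition of the space \<open>\<Z>(\<Omega>)\<close>.\<close>

definition Z_associated ::
  "'a::euclidean_space set \<Rightarrow> ('a \<Rightarrow> real) \<Rightarrow> ('a \<Rightarrow> real) \<Rightarrow> ('a \<Rightarrow> real) \<Rightarrow> bool" where
  "Z_associated \<Omega> f L R \<longleftrightarrow>
     (\<forall>x\<in>\<Omega>. 0 < L x \<and> 0 < R x \<and>
        (\<forall>h\<in>ball 0 (R x). \<bar>second_diff f h x\<bar> \<le> L x * (norm h)\<^sup>2))"

definition Z_space :: "'a::euclidean_space set \<Rightarrow> ('a \<Rightarrow> real) set" where
  "Z_space \<Omega> = {f \<in> Linf_space. \<exists>L R. Z_associated \<Omega> f L R}"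


section \<open>The operator with Fourier multiplier \<open>\<Phi>(|y|\<^sup>2)\<close>\<close>

text \<open>Unitary normalisation in angular frequency, for which \<open>-\<Delta>\<close> has multiplier \<open>|y|\<^sup>2\<close>.\<close>

definition fourier_L1 :: "('a::euclidean_space \<Rightarrow> complex) \<Rightarrow> 'a \<Rightarrow> complex" where
  "fourier_L1 f y =
     complex_of_real ((2 * pi) powr (- real DIM('a) / 2)) *
     (LINT x|lebesgue. cis (- (x \<bullet> y)) * f x)"

definition L2_limit ::
  "(nat \<Rightarrow> 'a::euclidean_space \<Rightarrow> complex) \<Rightarrow> ('a \<Rightarrow> complex) \<Rightarrow> bool" where
  "L2_limit s f \<longleftrightarrow>
     (\<lambda>n. \<integral>\<^sup>+x. ennreal ((norm (s n x - f x))\<^sup>2) \<partial>lebesgue) \<longlonglongrightarrow> 0"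

text \<open>\<open>F\<close> is a representative of the Fourier--Plancherel transform of \<open>f\<close>.\<close>

definition has_fourier_L2 ::
  "('a::euclidean_space \<Rightarrow> complex) \<Rightarrow> ('a \<Rightarrow> complex) \<Rightarrow> bool" where
  "has_fourier_L2 f F \<longleftrightarrow>
     f \<in> L2_space \<and> F \<in> L2_space \<and>
     (\<exists>s. (\<forall>n. s n \<in> L1_space \<inter> L2_space) \<and> L2_limit s f \<and>
          L2_limit (\<lambda>n. fourier_L1 (s n)) F)"

text \<open>\<open>Phi_Laplacian \<Phi> f g\<close>: \<open>f\<close> is in the domain of \<open>\<Phi>(-\<Delta>)\<close> in \<open>L\<^sup>2\<close> and
  \<open>g\<close> is a representative of \<open>\<Phi>(-\<Delta>)f\<close>. The relations below do not distinguish functions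
  that agree almost everywhere.\<close>

definition Phi_Laplacian ::
  "(real \<Rightarrow> real) \<Rightarrow> ('a::euclidean_space \<Rightarrow> complex) \<Rightarrow> ('a \<Rightarrow> complex) \<Rightarrow> bool" where
  "Phi_Laplacian \<Phi> f g \<longleftrightarrow>
     (\<exists>F G. has_fourier_L2 f F \<and> has_fourier_L2 g G \<and>
        (AE y in lebesgue. G y = complex_of_real (\<Phi> ((norm y)\<^sup>2)) * F y))"

definition schroedinger_op ::
  "(real \<Rightarrow> real) \<Rightarrow> ('a::euclidean_space \<Rightarrow> real) \<Rightarrow> ('a \<Rightarrow> complex) \<Rightarrow> ('a \<Rightarrow> complex) \<Rightarrow> bool"
  where
  "schroedinger_op \<Phi> V f g \<longleftrightarrow>
     g \<in> L2_space \<and>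
     (\<exists>u. Phi_Laplacian \<Phi> f u \<and>
        (AE x in lebesgue. g x = u x + complex_of_real (V x) * f x))"

text \<open>The standing assumption on \<open>\<phi>\<close> and \<open>V\<close>. The last clause fixes the representative of the
  potential, which the equation \<open>H\<phi> = 0\<close> determines only almost everywhere.\<close>

definition zero_energy_state ::
  "(real \<Rightarrow> real) \<Rightarrow> (real \<Rightarrow> real) \<Rightarrow> ('a::euclidean_space \<Rightarrow> real) \<Rightarrow> ('a \<Rightarrow> real) \<Rightarrow> bool" where
  "zero_energy_state \<Phi> \<mu> V \<phi> \<longleftrightarrow>
     \<phi> \<in> L2_space \<inter> Linf_space \<and> (\<forall>x. 0 < \<phi> x) \<and>
     schroedinger_op \<Phi> V (\<lambda>x. complex_of_real (\<phi> x)) (\<lambda>_. 0) \<and>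
     (\<forall>x. V x = 1 / (2 * \<phi> x) *
        (LINT h|lebesgue. second_diff \<phi> h x * jump_kernel DIM('a) \<mu> (norm h)))"

end

theory Submission
  imports Defs
begin

text \<open>
  Two independent facts are combined: a one-sided estimate of the integrand in the pointwise
  expression for \<open>V\<close>, and the finiteness of the Levy integrals on the right-hand side.

  The estimate. On the ball of radius \<open>R x\<close> the second difference of \<open>\<phi>\<close> is at most
  \<open>L x * |h|\<^sup>2\<close>. Outside it, \<open>\<phi> (x + h)\<close> and \<open>\<phi> (x - h)\<close> are at most the essential supremum
  for almost every \<open>h\<close>, and the middle term \<open>- 2 * \<phi> x\<close> is negative. The last point matters:
  the value of \<open>\<phi>\<close> at the single point \<open>x\<close> is not controlled by an essential supremum, so the
  essential supremum bounds the second difference from above only, which is what an upper bound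
  for \<open>V\<close> needs (lemma \<open>second_diff_AE_le\<close>). Integrating against the jump kernel gives a bound that is
  better by a factor of two in the tail term.

  The finiteness. The jump kernel is a mixture, with weights \<open>\<mu> t\<close>, of the Gaussian heat kernels
  of variance \<open>2 t\<close> in each coordinate. Each of them has mass one and second moment of order \<open>t\<close>,
  so the integral of \<open>min 1 |h|\<^sup>2\<close> against it is of order \<open>min 1 t\<close>
  (lemma \<open>nn_integral_heat_kernel_truncated_second_moment\<close>). By Tonelli's theorem the integral of
  \<open>min 1 |h|\<^sup>2\<close> against the jump kernel is at most a constant times the integral of
  \<open>min 1 t * \<mu> t\<close>, which is finite for a Bernstein pair (lemma \<open>jump_kernel_levy_integrable\<close>).
  Tails and truncated second moments are dominated by multiples of it.
\<close>

section \<open>The Gaussian heat kernel\<close>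

definition heat_kernel :: "real \<Rightarrow> 'a::euclidean_space \<Rightarrow> real" where
  "heat_kernel t h = (4 * pi * t) powr (- real DIM('a) / 2) * exp (- ((norm h)\<^sup>2 / (4 * t)))"

lemma heat_kernel_nonneg: "0 \<le> heat_kernel t h"
  by (simp add: heat_kernel_def)

lemma heat_kernel_measurable [measurable]:
  "case_prod heat_kernel \<in> borel_measurable (borel \<Otimes>\<^sub>M borel)"
  unfolding heat_kernel_def by measurable

text \<open>Since \<open>|h|\<^sup>2\<close> is the sum of the squares of the coordinates, the Gaussian splits into
  one-dimensional factors, whose integrals are known.\<close>

lemma heat_kernel_eq_prod_normal_density:
  assumes "0 < t"
  shows "heat_kernel t h = (\<Prod>b\<in>Basis. normal_density 0 (sqrt (2 * t)) ((h::'a::euclidean_space) \<bullet> b))"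
proof -
  have "normal_density 0 (sqrt (2 * t)) x = 1 / sqrt (4 * pi * t) * exp (- (x\<^sup>2 / (4 * t)))" for x
  proof -
    have "(sqrt (2 * t))\<^sup>2 = 2 * t" using assms by simp
    moreover have "2 * pi * (2 * t) = 4 * pi * t" "2 * (2 * t) = 4 * t" by simp_all
    ultimately show ?thesis
      unfolding normal_density_def by (simp only: diff_zero minus_divide_left)
  qed
  then have "(\<Prod>b\<in>Basis. normal_density 0 (sqrt (2 * t)) (h \<bullet> b))
      = (\<Prod>b::'a\<in>Basis. 1 / sqrt (4 * pi * t)) * (\<Prod>b\<in>Basis. exp (- ((h \<bullet> b)\<^sup>2 / (4 * t))))"
    by (simp only: prod.distrib)
  also have "(\<Prod>b\<in>Basis. exp (- ((h \<bullet> b)\<^sup>2 / (4 * t)))) = exp (- ((norm h)\<^sup>2 / (4 * t)))"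
  proof -
    have "(norm h)\<^sup>2 = (\<Sum>b\<in>Basis. (h \<bullet> b)\<^sup>2)"
      unfolding power2_norm_eq_inner by (subst euclidean_inner) (simp add: power2_eq_square)
    then show ?thesis
      by (simp add: exp_sum[symmetric] sum_negf sum_divide_distrib)
  qed
  also have "(\<Prod>b::'a\<in>Basis. 1 / sqrt (4 * pi * t)) = (4 * pi * t) powr (- real DIM('a) / 2)"
  proof -
    have pos: "0 < 4 * pi * t" using assms by simp
    have "1 / sqrt (4 * pi * t) = (4 * pi * t) powr (- (1 / 2))"
      unfolding powr_minus_divide powr_half_sqrt[OF less_imp_le[OF pos]] ..
    then have "(\<Prod>b::'a\<in>Basis. 1 / sqrt (4 * pi * t)) = ((4 * pi * t) powr (- (1 / 2))) ^ DIM('a)"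
      by (simp only: prod_constant)
    also have "\<dots> = (4 * pi * t) powr (real DIM('a) * (- (1 / 2)))"
      by (rule powr_power) (use pos in linarith)
    also have "real DIM('a) * (- (1 / 2)) = - real DIM('a) / 2"
      by simp
    finally show ?thesis .
  qed
  finally show ?thesis by (simp add: heat_kernel_def)
qed

lemma nn_integral_heat_kernel:
  assumes "0 < t"
  shows "(\<integral>\<^sup>+h. ennreal (heat_kernel t (h::'a::euclidean_space)) \<partial>lborel) = 1"
proof -
  have "(\<integral>\<^sup>+h. ennreal (heat_kernel t (h::'a)) \<partial>lborel)
      = (\<integral>\<^sup>+h. (\<Prod>b\<in>Basis. ennreal (normal_density 0 (sqrt (2 * t)) ((h::'a) \<bullet> b))) \<partial>lborel)"
    by (simp add: heat_kernel_eq_prod_normal_density[OF assms] prod_ennreal)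
  also have "\<dots> = (\<Prod>b::'a\<in>Basis. \<integral>\<^sup>+x. ennreal (normal_density 0 (sqrt (2 * t)) x) \<partial>lborel)"
    by (rule nn_integral_lborel_prod) auto
  also have "\<dots> = 1"
    using assms by (simp add: nn_integral_eq_integral)
  finally show ?thesis .
qed

text \<open>With \<open>s = |h|\<^sup>2 / (4 t)\<close>, the factor \<open>s\<close> is absorbed by half of the exponential decay:
  \<open>s * exp (- s) \<le> exp (- s / 2)\<close>. The halved exponent belongs to the heat kernel at time \<open>2 t\<close>,
  and its normalisation accounts for the power of two. Integrating in \<open>h\<close> then bounds the second
  moment by a multiple of \<open>t\<close> without computing it.\<close>

lemma heat_kernel_second_moment_pointwise:
  assumes "0 < t"
  shows "(norm h)\<^sup>2 * heat_kernel t (h::'a::euclidean_space)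
     \<le> 4 * 2 powr (real DIM('a) / 2) * t * heat_kernel (2 * t) h"
proof -
  define s where "s = (norm h)\<^sup>2 / (4 * t)"
  have s: "s \<le> exp (s / 2)"
  proof -
    \<comment> \<open>\<open>s \<le> (1 + s / 4)\<^sup>2\<close> holds because the difference is \<open>(1 - s / 4)\<^sup>2\<close>.\<close>
    have "s / 2 \<le> exp (s / 2) / 2"
    proof -
      have "0 \<le> s / 4" using assms by (simp add: s_def)
      then have "(1 + s / 4)\<^sup>2 \<le> (exp (s / 4))\<^sup>2"
        by (intro power_mono exp_ge_add_one_self) auto
      also have "\<dots> = exp (s / 2)"
        by (simp flip: exp_of_nat_mult exp_double)
      also have "s \<le> (1 + s / 4)\<^sup>2"
        using zero_le_power2[of "1 - s / 4"] by (simp add: power2_eq_square algebra_simps)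
      finally show ?thesis by simp
    qed
    then show ?thesis by simp
  qed
  have "s * exp (- s) \<le> exp (s / 2) * exp (- s)"
    using s by (intro mult_right_mono) auto
  also have "\<dots> = exp (- (s / 2))"
    by (simp flip: exp_add)
  finally have bound: "s * exp (- s) \<le> exp (- (s / 2))" .
  have split: "(4 * pi * t) powr (- real DIM('a) / 2)
      = 2 powr (real DIM('a) / 2) * (4 * pi * (2 * t)) powr (- real DIM('a) / 2)"
  proof -
    have "(4 * pi * (2 * t)) powr (- real DIM('a) / 2)
        = 2 powr (- real DIM('a) / 2) * (4 * pi * t) powr (- real DIM('a) / 2)"
      using assms by (simp flip: powr_mult add: mult_ac)
    then show ?thesis
      by (simp flip: powr_add mult.assoc)
  qed
  have "(norm h)\<^sup>2 * heat_kernel t h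
      = 4 * t * (4 * pi * t) powr (- real DIM('a) / 2) * (s * exp (- s))"
    using assms by (simp add: heat_kernel_def s_def)
  also have "\<dots> \<le> 4 * t * (4 * pi * t) powr (- real DIM('a) / 2) * exp (- (s / 2))"
    using assms bound by (intro mult_left_mono) auto
  also have "exp (- (s / 2)) = exp (- ((norm h)\<^sup>2 / (4 * (2 * t))))"
    by (simp add: s_def)
  finally show ?thesis
    unfolding split by (simp add: heat_kernel_def mult_ac)
qed

text \<open>The bound \<open>1\<close> comes from the total mass and the bound linear in \<open>t\<close> from the second moment.
  The maximum in \<open>C\<close> serves both of them.\<close>

lemma nn_integral_heat_kernel_truncated_second_moment:
  assumes "0 < t"
  defines "C \<equiv> max 1 (4 * 2 powr (real DIM('a::euclidean_space) / 2))"
  shows "(\<integral>\<^sup>+h. ennreal (min 1 ((norm h)\<^sup>2) * heat_kernel t (h::'a)) \<partial>lborel)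
     \<le> ennreal (C * min 1 t)"
proof -
  let ?K = "4 * 2 powr (real DIM('a) / 2)"
  have "(\<integral>\<^sup>+h. ennreal (min 1 ((norm h)\<^sup>2) * heat_kernel t (h::'a)) \<partial>lborel)
      \<le> (\<integral>\<^sup>+h. ennreal (heat_kernel t (h::'a)) \<partial>lborel)"
    by (intro nn_integral_mono ennreal_leI mult_left_le_one_le) (auto simp: heat_kernel_nonneg)
  also have "\<dots> = ennreal 1"
    using assms by (simp add: nn_integral_heat_kernel)
  finally have mass: "(\<integral>\<^sup>+h. ennreal (min 1 ((norm h)\<^sup>2) * heat_kernel t (h::'a)) \<partial>lborel) \<le> ennreal 1" .
  have "(\<integral>\<^sup>+h. ennreal (min 1 ((norm h)\<^sup>2) * heat_kernel t (h::'a)) \<partial>lborel)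
      \<le> (\<integral>\<^sup>+h. ennreal (?K * t) * ennreal (heat_kernel (2 * t) (h::'a)) \<partial>lborel)"
  proof (intro nn_integral_mono)
    fix h :: 'a
    have "min 1 ((norm h)\<^sup>2) * heat_kernel t h \<le> (norm h)\<^sup>2 * heat_kernel t h"
      by (intro mult_right_mono) (auto simp: heat_kernel_nonneg)
    also note heat_kernel_second_moment_pointwise[OF assms(1)]
    finally show "ennreal (min 1 ((norm h)\<^sup>2) * heat_kernel t h)
        \<le> ennreal (?K * t) * ennreal (heat_kernel (2 * t) h)"
      using assms(1) by (simp add: ennreal_mult[symmetric] heat_kernel_nonneg ennreal_leI)
  qed
  also have "\<dots> = ennreal (?K * t)"
    using assms(1) by (simp add: nn_integral_cmult nn_integral_heat_kernel)
  finally have second: "(\<integral>\<^sup>+h. ennreal (min 1 ((norm h)\<^sup>2) * heat_kernel t (h::'a)) \<partial>lborel)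
      \<le> ennreal (?K * t)" .
  have "min 1 (?K * t) \<le> C * min 1 t"
  proof (cases "t \<le> 1")
    case True
    have "?K * t \<le> C * t"
      using assms(1) by (intro mult_right_mono) (auto simp: C_def)
    then show ?thesis using True by simp
  next
    case False
    then show ?thesis by (simp add: C_def)
  qed
  moreover have "(\<integral>\<^sup>+h. ennreal (min 1 ((norm h)\<^sup>2) * heat_kernel t (h::'a)) \<partial>lborel)
      \<le> ennreal (min 1 (?K * t))"
    using mass second by (simp add: min_def)
  ultimately show ?thesis
    by (meson ennreal_leI order_trans)
qed


section \<open>The jump kernel is the density of a Levy measure\<close>

lemma completely_monotone_nonneg:
  assumes "completely_monotone \<mu>" "0 < t"
  shows "0 \<le> \<mu> t"
proof -
  have "0 \<le> (-1) ^ 0 * (deriv ^^ 0) \<mu> t"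
    using assms unfolding completely_monotone_def by blast
  then show ?thesis by simp
qed

text \<open>Only the values of \<open>\<mu>\<close> on the positive half-line are constrained. There \<open>\<mu>\<close> is
  differentiable, hence continuous; the cut-off makes the function measurable on the whole line.\<close>

lemma completely_monotone_measurable:
  assumes "completely_monotone \<mu>"
  shows "(\<lambda>t. indicator {0<..} t * \<mu> t) \<in> borel_measurable borel"
proof -
  have "\<mu> differentiable (at t)" if "0 < t" for t
  proof -
    have "(deriv ^^ 0) \<mu> differentiable (at t)"
      using assms that unfolding completely_monotone_def by blast
    then show ?thesis by simp
  qed
  then have "continuous_on {0<..} \<mu>"
    by (auto intro!: continuous_at_imp_continuous_on differentiable_imp_continuous_within)
  then show ?thesis
    using borel_measurable_continuous_on_indicator[of "{0<..}" \<mu>] by simp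
qed

lemma jump_kernel_eq:
  "jump_kernel d \<mu> r = (4 * pi) powr (- real d / 2) *
     (LINT t|lborel. t powr (- real d / 2) * exp (- (r\<^sup>2 / (4 * t))) * (indicator {0<..} t * \<mu> t))"
  unfolding jump_kernel_def set_lebesgue_integral_def by (simp add: mult_ac)

lemma jump_kernel_nonneg:
  assumes "completely_monotone \<mu>"
  shows "0 \<le> jump_kernel d \<mu> r"
proof -
  have "0 \<le> indicator {0<..} t * \<mu> t" for t
    by (simp add: indicator_def completely_monotone_nonneg[OF assms])
  then have "0 \<le> t powr (- real d / 2) * exp (- (r\<^sup>2 / (4 * t))) * (indicator {0<..} t * \<mu> t)" for t
    by (intro mult_nonneg_nonneg[OF mult_nonneg_nonneg]) auto
  then show ?thesis
    unfolding jump_kernel_eq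
    by (intro mult_nonneg_nonneg[OF powr_ge_zero] Bochner_Integration.integral_nonneg)
qed

lemma jump_kernel_measurable:
  assumes "completely_monotone \<mu>"
  shows "jump_kernel d \<mu> \<in> borel_measurable borel"
proof -
  note [measurable] = completely_monotone_measurable[OF assms]
  show ?thesis
    unfolding jump_kernel_eq by measurable
qed

text \<open>An inequality suffices in the sequel and holds for every \<open>h\<close>, including \<open>h = 0\<close>: where the
  mixture diverges, the Bochner integral in the definition of the jump kernel has the value \<open>0\<close>.\<close>

lemma jump_kernel_le_nn_integral_heat_kernel:
  fixes h :: "'a::euclidean_space"
  assumes "completely_monotone \<mu>"
  shows "ennreal (jump_kernel DIM('a) \<mu> (norm h))
     \<le> (\<integral>\<^sup>+t. ennreal (heat_kernel t h * (indicator {0<..} t * \<mu> t)) \<partial>lborel)"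
proof -
  let ?f = "\<lambda>t. heat_kernel t h * (indicator {0<..} t * \<mu> t)"
  have eq: "jump_kernel DIM('a) \<mu> (norm h) = (LINT t|lborel. ?f t)"
    unfolding jump_kernel_eq integral_mult_right_zero[symmetric]
    by (intro Bochner_Integration.integral_cong)
       (auto simp: heat_kernel_def powr_mult indicator_def)
  show ?thesis
  proof (cases "integrable lborel ?f")
    case True
    have "0 \<le> ?f t" for t
      by (simp add: indicator_def heat_kernel_nonneg completely_monotone_nonneg[OF assms])
    then show ?thesis
      using True by (simp add: eq nn_integral_eq_integral)
  next
    case False
    then show ?thesis by (simp add: eq not_integrable_integral_eq)
  qed
qed

text \<open>Inserting the Gaussian mixture and exchanging the integrals reduces integrability in space
  to the integrability of \<open>min 1 t * \<mu> t\<close>.\<close>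

lemma jump_kernel_levy_integrable:
  assumes "complete_bernstein_pair \<Phi> \<mu>"
  shows "(\<integral>\<^sup>+h. ennreal (min 1 ((norm h)\<^sup>2) * jump_kernel DIM('a) \<mu> (norm (h::'a::euclidean_space)))
     \<partial>lborel) < \<infinity>"
proof -
  have cm: "completely_monotone \<mu>"
    using assms by (simp add: complete_bernstein_pair_def)
  define m where "m = (\<lambda>t. indicator {0<..} t * \<mu> t)"
  define C where "C = max 1 (4 * 2 powr (real DIM('a) / 2))"
  have C: "0 \<le> C" by (simp add: C_def)
  have m [measurable]: "m \<in> borel_measurable borel"
    unfolding m_def by (rule completely_monotone_measurable[OF cm])
  have m_nonneg: "0 \<le> m t" for t
    by (simp add: m_def indicator_def completely_monotone_nonneg[OF cm])
  have int: "integrable lborel (\<lambda>t. min 1 t * m t)"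
    using assms unfolding complete_bernstein_pair_def set_integrable_def m_def
    by (simp add: mult_ac)
  have "(\<integral>\<^sup>+h. ennreal (min 1 ((norm h)\<^sup>2) * jump_kernel DIM('a) \<mu> (norm (h::'a))) \<partial>lborel)
      \<le> (\<integral>\<^sup>+h. (\<integral>\<^sup>+t. ennreal (min 1 ((norm h)\<^sup>2) * heat_kernel t (h::'a)) * ennreal (m t) \<partial>lborel)
          \<partial>lborel)"
  proof (intro nn_integral_mono)
    fix h :: 'a
    have "ennreal (min 1 ((norm h)\<^sup>2) * jump_kernel DIM('a) \<mu> (norm h))
        = ennreal (min 1 ((norm h)\<^sup>2)) * ennreal (jump_kernel DIM('a) \<mu> (norm h))"
      by (simp add: ennreal_mult jump_kernel_nonneg[OF cm])
    also have "\<dots> \<le> ennreal (min 1 ((norm h)\<^sup>2)) * (\<integral>\<^sup>+t. ennreal (heat_kernel t h * m t) \<partial>lborel)"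
      unfolding m_def by (intro mult_left_mono jump_kernel_le_nn_integral_heat_kernel[OF cm]) auto
    also have "\<dots> = (\<integral>\<^sup>+t. ennreal (min 1 ((norm h)\<^sup>2)) * ennreal (heat_kernel t h * m t) \<partial>lborel)"
      by (rule nn_integral_cmult[symmetric]) measurable
    also have "\<dots> = (\<integral>\<^sup>+t. ennreal (min 1 ((norm h)\<^sup>2) * heat_kernel t h) * ennreal (m t) \<partial>lborel)"
      by (simp add: ennreal_mult heat_kernel_nonneg m_nonneg mult.assoc)
    finally show "ennreal (min 1 ((norm h)\<^sup>2) * jump_kernel DIM('a) \<mu> (norm h)) \<le> \<dots>" .
  qed
  also have "\<dots> = (\<integral>\<^sup>+t. (\<integral>\<^sup>+h. ennreal (min 1 ((norm h)\<^sup>2) * heat_kernel t (h::'a)) * ennreal (m t) \<partial>lborel)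
      \<partial>lborel)"
    by (rule lborel_pair.Fubini') measurable
  also have "\<dots> = (\<integral>\<^sup>+t. (\<integral>\<^sup>+h. ennreal (min 1 ((norm h)\<^sup>2) * heat_kernel t (h::'a)) \<partial>lborel) * ennreal (m t)
      \<partial>lborel)"
    by (intro nn_integral_cong nn_integral_multc) measurable
  also have "\<dots> \<le> (\<integral>\<^sup>+t. ennreal C * ennreal (min 1 t * m t) \<partial>lborel)"
  proof (intro nn_integral_mono)
    fix t :: real
    show "(\<integral>\<^sup>+h. ennreal (min 1 ((norm h)\<^sup>2) * heat_kernel t (h::'a)) \<partial>lborel) * ennreal (m t)
        \<le> ennreal C * ennreal (min 1 t * m t)"
    proof (cases "0 < t")
      case True
      have "(\<integral>\<^sup>+h. ennreal (min 1 ((norm h)\<^sup>2) * heat_kernel t (h::'a)) \<partial>lborel) * ennreal (m t)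
          \<le> ennreal (C * min 1 t) * ennreal (m t)"
        unfolding C_def
        by (intro mult_right_mono nn_integral_heat_kernel_truncated_second_moment True) auto
      also have "\<dots> = ennreal C * ennreal (min 1 t * m t)"
        using True C by (simp add: ennreal_mult m_nonneg mult.assoc)
      finally show ?thesis .
    next
      case False
      then show ?thesis by (simp add: m_def)
    qed
  qed
  also have "\<dots> = ennreal C * (\<integral>\<^sup>+t. ennreal (min 1 t * m t) \<partial>lborel)"
    by (rule nn_integral_cmult) measurable
  also have "\<dots> < \<infinity>"
  proof -
    have "(\<integral>\<^sup>+t. ennreal (min 1 t * m t) \<partial>lborel) < \<infinity>"
      using integrableD(2)[OF int] by (simp add: top.not_eq_extremum)
    then show ?thesis by (simp add: ennreal_mult_less_top)
  qed
  finally show ?thesis .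
qed

text \<open>The ball contains the origin, so restricting the measure to the punctured space does not
  affect the complement of the ball.\<close>

lemma levy_measure_compl_ball:
  assumes "completely_monotone \<mu>" "0 < R"
  shows "emeasure (levy_measure \<mu>) (- ball (0::'a::euclidean_space) R)
     = (\<integral>\<^sup>+h. ennreal (indicator (- ball 0 R) h * jump_kernel DIM('a) \<mu> (norm (h::'a))) \<partial>lborel)"
proof -
  note [measurable] = jump_kernel_measurable[OF assms(1)]
  let ?\<Omega> = "UNIV - {0::'a}"
  have sub: "- ball 0 R \<subseteq> ?\<Omega>"
    using assms(2) by auto
  have A: "- ball (0::'a) R \<in> sets (restrict_space lborel ?\<Omega>)"
    by (subst sets_restrict_space_iff) (use sub in auto)
  have "emeasure (levy_measure \<mu>) (- ball (0::'a) R)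
      = (\<integral>\<^sup>+h. ennreal (jump_kernel DIM('a) \<mu> (norm h)) * indicator (- ball 0 R) h
          \<partial>restrict_space lborel ?\<Omega>)"
    unfolding levy_measure_def
    by (rule emeasure_density[OF _ A], rule measurable_restrict_space1) measurable
  also have "\<dots> = (\<integral>\<^sup>+h. ennreal (jump_kernel DIM('a) \<mu> (norm h)) * indicator (- ball 0 R) h
      * indicator ?\<Omega> h \<partial>lborel)"
    by (rule nn_integral_restrict_space) simp
  also have "\<dots> = (\<integral>\<^sup>+h. ennreal (indicator (- ball 0 R) h * jump_kernel DIM('a) \<mu> (norm (h::'a))) \<partial>lborel)"
    using assms(2) by (intro nn_integral_cong) (auto split: split_indicator)
  finally show ?thesis .
qed

lemma levy_moment_eq:
  "levy_moment TYPE('a::euclidean_space) \<mu> R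
     = (\<integral>\<^sup>+h. ennreal (indicator (ball 0 R) h * ((norm h)\<^sup>2 * jump_kernel DIM('a) \<mu> (norm (h::'a))))
         \<partial>lborel)"
  unfolding levy_moment_def by (intro nn_integral_cong) (auto simp: indicator_def)

lemma levy_tail_finite:
  assumes "complete_bernstein_pair \<Phi> \<mu>" "0 < R"
  shows "emeasure (levy_measure \<mu>) (- ball (0::'a::euclidean_space) R) < \<infinity>"
proof -
  have cm: "completely_monotone \<mu>"
    using assms by (simp add: complete_bernstein_pair_def)
  note [measurable] = jump_kernel_measurable[OF cm]
  \<comment> \<open>The least \<open>c\<close> with \<open>1 \<le> c * min 1 |h|\<^sup>2\<close> for all \<open>|h| \<ge> R\<close>.\<close>
  define c where "c = 1 / min 1 (R\<^sup>2)"
  have c: "0 \<le> c" using assms(2) by (simp add: c_def)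
  have "emeasure (levy_measure \<mu>) (- ball (0::'a) R)
      \<le> (\<integral>\<^sup>+h. ennreal c * ennreal (min 1 ((norm h)\<^sup>2) * jump_kernel DIM('a) \<mu> (norm (h::'a))) \<partial>lborel)"
    unfolding levy_measure_compl_ball[OF cm assms(2)]
  proof (intro nn_integral_mono)
    fix h :: 'a
    have "indicator (- ball 0 R) h \<le> c * min 1 ((norm h)\<^sup>2)"
    proof (cases "R \<le> norm h")
      case True
      then have "R\<^sup>2 \<le> (norm h)\<^sup>2"
        using assms(2) by (intro power_mono) auto
      then have "min 1 (R\<^sup>2) \<le> min 1 ((norm h)\<^sup>2)" "0 < min 1 (R\<^sup>2)"
        using assms(2) by (auto intro: min.coboundedI2)
      then show ?thesis
        using True by (simp add: c_def)
    next
      case False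
      then show ?thesis using c by (simp add: indicator_def)
    qed
    from mult_right_mono[OF this jump_kernel_nonneg[OF cm]]
    show "ennreal (indicator (- ball 0 R) h * jump_kernel DIM('a) \<mu> (norm h))
        \<le> ennreal c * ennreal (min 1 ((norm h)\<^sup>2) * jump_kernel DIM('a) \<mu> (norm h))"
      by (subst ennreal_mult'[OF c, symmetric]) (simp only: mult.assoc ennreal_leI)
  qed
  also have "\<dots> = ennreal c * (\<integral>\<^sup>+h. ennreal (min 1 ((norm h)\<^sup>2) * jump_kernel DIM('a) \<mu> (norm (h::'a))) \<partial>lborel)"
    by (rule nn_integral_cmult) measurable
  also have "\<dots> < \<infinity>"
    using jump_kernel_levy_integrable[OF assms(1), where 'a='a] by (simp add: ennreal_mult_less_top)
  finally show ?thesis .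
qed

lemma levy_moment_finite:
  assumes "complete_bernstein_pair \<Phi> \<mu>"
  shows "levy_moment TYPE('a::euclidean_space) \<mu> R < \<infinity>"
proof -
  have cm: "completely_monotone \<mu>"
    using assms by (simp add: complete_bernstein_pair_def)
  note [measurable] = jump_kernel_measurable[OF cm]
  \<comment> \<open>A constant with \<open>|h|\<^sup>2 \<le> c * min 1 |h|\<^sup>2\<close> for all \<open>|h| < R\<close>.\<close>
  define c where "c = max 1 (R\<^sup>2)"
  have c: "0 \<le> c" "1 \<le> c" "R\<^sup>2 \<le> c" by (auto simp: c_def)
  have "levy_moment TYPE('a) \<mu> R
      \<le> (\<integral>\<^sup>+h. ennreal c * ennreal (min 1 ((norm h)\<^sup>2) * jump_kernel DIM('a) \<mu> (norm (h::'a))) \<partial>lborel)"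
    unfolding levy_moment_eq
  proof (intro nn_integral_mono)
    fix h :: 'a
    have "indicator (ball 0 R) h * (norm h)\<^sup>2 \<le> c * min 1 ((norm h)\<^sup>2)"
    proof (cases "norm h < R")
      case True
      then have "(norm h)\<^sup>2 \<le> R\<^sup>2"
        by (intro power_mono) auto
      moreover have "(norm h)\<^sup>2 \<le> c * (norm h)\<^sup>2"
        using mult_right_mono[OF c(2), of "(norm h)\<^sup>2"] by simp
      ultimately show ?thesis
        using True c by (auto simp: min_def)
    next
      case False
      then show ?thesis using c by (simp add: indicator_def)
    qed
    from mult_right_mono[OF this jump_kernel_nonneg[OF cm]]
    show "ennreal (indicator (ball 0 R) h * ((norm h)\<^sup>2 * jump_kernel DIM('a) \<mu> (norm h)))
        \<le> ennreal c * ennreal (min 1 ((norm h)\<^sup>2) * jump_kernel DIM('a) \<mu> (norm h))"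
      using c by (simp add: ennreal_mult[symmetric] jump_kernel_nonneg[OF cm] ennreal_leI mult.assoc)
  qed
  also have "\<dots> = ennreal c * (\<integral>\<^sup>+h. ennreal (min 1 ((norm h)\<^sup>2) * jump_kernel DIM('a) \<mu> (norm (h::'a))) \<partial>lborel)"
    by (rule nn_integral_cmult) measurable
  also have "\<dots> < \<infinity>"
    using jump_kernel_levy_integrable[OF assms, where 'a='a] by (simp add: ennreal_mult_less_top)
  finally show ?thesis .
qed


section \<open>Essential bounds on second differences\<close>

lemma Linf_norm_AE_bound:
  assumes "f \<in> Linf_space"
  shows "AE x in lborel. norm (f x) \<le> Linf_norm f"
proof -
  let ?S = "esssup lebesgue (\<lambda>x. ereal (norm (f x)))"
  have "AE x in lebesgue. ereal (norm (f x)) \<le> ?S"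
    by (rule esssup_AE)
  moreover have "?S < \<infinity>"
    using assms by (simp add: Linf_space_def)
  ultimately have "AE x in lebesgue. norm (f x) \<le> Linf_norm f"
    unfolding Linf_norm_def by (cases ?S) (auto elim: eventually_mono)
  then show ?thesis by (simp add: AE_completion_iff)
qed

text \<open>Lebesgue measure is not zero, so the almost everywhere bound holds at some point.\<close>

lemma Linf_norm_nonneg:
  assumes "(f :: 'a::euclidean_space \<Rightarrow> 'b::euclidean_space) \<in> Linf_space"
  shows "0 \<le> Linf_norm f"
proof -
  have "\<exists>x. norm (f x) \<le> Linf_norm f"
  proof (rule ccontr)
    assume "\<not> ?thesis"
    with Linf_norm_AE_bound[OF assms] have "AE x::'a in lborel. False" by simp
    then have "emeasure lborel (UNIV :: 'a set) = 0"
      by (simp add: AE_iff_measurable[OF _ refl])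
    then show False by simp
  qed
  then show ?thesis using norm_ge_zero order_trans by blast
qed

lemma AE_lborel_translate_reflect:
  assumes "AE y in lborel. P (y::'a::euclidean_space)"
  shows "AE h in lborel. P (x + h)" and "AE h in lborel. P (x - h)"
proof -
  have shift: "AE h in lborel. P (x + h)"
    using AE_distrD[of "(+) x" lborel borel P] assms unfolding lborel_distr_plus by simp
  then show "AE h in lborel. P (x + h)" .
  have "distr lborel borel (\<lambda>h. x - h) = (lborel :: 'a measure)"
    by (subst (2) lborel_affine[of "-1" x]) (auto simp: density_1)
  then show "AE h in lborel. P (x - h)"
    by (intro AE_distrD[of "\<lambda>h. x - h" lborel borel P]) (measurable, simp only: assms)
qed

text \<open>The sign of \<open>f x\<close> makes the middle term of the second difference harmless; the other two
  terms are translates and reflections of \<open>f\<close> in the variable \<open>h\<close>.\<close>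

lemma second_diff_AE_le:
  assumes "f \<in> Linf_space" "0 \<le> f x"
  shows "AE h in lborel. second_diff f h x \<le> 2 * Linf_norm f"
proof -
  note b = Linf_norm_AE_bound[OF assms(1)]
  from AE_lborel_translate_reflect[OF b, of x] show ?thesis
    by eventually_elim (use assms(2) in \<open>auto simp: second_diff_def\<close>)
qed


section \<open>The upper bound for the potential\<close>

theorem theorem3p1:
  fixes \<Phi> \<mu> :: "real \<Rightarrow> real"
    and V \<phi> L R :: "'a::euclidean_space \<Rightarrow> real"
    and x :: 'a
  assumes "complete_bernstein_pair \<Phi> \<mu>"
    and "zero_energy_state \<Phi> \<mu> V \<phi>"
    and "\<phi> \<in> Z_space UNIV"
    and "Z_associated UNIV \<phi> L R"
  shows "ereal (V x) \<le>
           ereal (2 * Linf_norm \<phi> / \<phi> x)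
             * enn2ereal (emeasure (levy_measure \<mu>) (- ball (0::'a) (R x)))
           + ereal (L x / (2 * \<phi> x)) * enn2ereal (levy_moment TYPE('a) \<mu> (R x))
       \<and> ereal (2 * Linf_norm \<phi> / \<phi> x)
             * enn2ereal (emeasure (levy_measure \<mu>) (- ball (0::'a) (R x)))
           + ereal (L x / (2 * \<phi> x)) * enn2ereal (levy_moment TYPE('a) \<mu> (R x)) < \<infinity>"
proof -
  let ?j = "\<lambda>h::'a. jump_kernel DIM('a) \<mu> (norm h)"
  let ?B = "ball (0::'a) (R x)"
  let ?M = "Linf_norm \<phi>"
  have cm: "completely_monotone \<mu>"
    using assms(1) by (simp add: complete_bernstein_pair_def)
  note [measurable] = jump_kernel_measurable[OF cm]
  have Linf: "\<phi> \<in> Linf_space" and pos: "0 < \<phi> x"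
    and V: "V x = 1 / (2 * \<phi> x) * (LINT h|lebesgue. second_diff \<phi> h x * ?j h)"
    using assms(2) by (auto simp: zero_energy_state_def)
  have M: "0 \<le> ?M" by (rule Linf_norm_nonneg[OF Linf])
  have R: "0 < R x" and L: "0 < L x"
    and Z: "\<And>h. h \<in> ?B \<Longrightarrow> \<bar>second_diff \<phi> h x\<bar> \<le> L x * (norm h)\<^sup>2"
    using assms(4) by (auto simp: Z_associated_def)
  obtain a where a: "0 \<le> a" "emeasure (levy_measure \<mu>) (- ?B) = ennreal a"
    using levy_tail_finite[OF assms(1) R, where 'a='a]
    by (cases "emeasure (levy_measure \<mu>) (- ?B)") auto
  obtain b where b: "0 \<le> b" "levy_moment TYPE('a) \<mu> (R x) = ennreal b"
    using levy_moment_finite[OF assms(1), where 'a='a and R="R x"]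
    by (cases "levy_moment TYPE('a) \<mu> (R x)") auto
  have [measurable]: "?B \<in> sets borel" by simp
  have tail_meas: "(\<lambda>h. ennreal (indicator (- ?B) h * ?j h)) \<in> borel_measurable lborel"
    by measurable
  have ball_meas: "(\<lambda>h. ennreal (indicator ?B h * ((norm h)\<^sup>2 * ?j h))) \<in> borel_measurable lborel"
    by measurable
  \<comment> \<open>The coercion to nonnegative extended reals discards the negative part of the integrand, so
    this bounds the integral from above also when the negative part is not controlled.\<close>
  have "(\<integral>\<^sup>+h. ennreal (second_diff \<phi> h x * ?j h) \<partial>lebesgue)
      = (\<integral>\<^sup>+h. ennreal (second_diff \<phi> h x * ?j h) \<partial>lborel)"
    by (rule nn_integral_completion)
  also have "\<dots> \<le> (\<integral>\<^sup>+h. ennreal (2 * ?M) * ennreal (indicator (- ?B) h * ?j h)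
      + ennreal (L x) * ennreal (indicator ?B h * ((norm h)\<^sup>2 * ?j h)) \<partial>lborel)"
  proof (rule nn_integral_mono_AE)
    show "AE h in lborel. ennreal (second_diff \<phi> h x * ?j h)
        \<le> ennreal (2 * ?M) * ennreal (indicator (- ?B) h * ?j h)
          + ennreal (L x) * ennreal (indicator ?B h * ((norm h)\<^sup>2 * ?j h))"
      using second_diff_AE_le[OF Linf less_imp_le[OF pos]]
    proof eventually_elim
      case (elim h)
      show ?case
      proof (cases "h \<in> ?B")
        case True
        have "second_diff \<phi> h x * ?j h \<le> L x * (norm h)\<^sup>2 * ?j h"
          using Z[OF True] by (intro mult_right_mono jump_kernel_nonneg[OF cm]) auto
        then show ?thesis
          using True L by (simp add: ennreal_mult[symmetric] jump_kernel_nonneg[OF cm] ennreal_leI mult.assoc)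
      next
        case False
        have "second_diff \<phi> h x * ?j h \<le> 2 * ?M * ?j h"
          using elim by (intro mult_right_mono jump_kernel_nonneg[OF cm])
        then show ?thesis
          using False M by (simp add: ennreal_mult[symmetric] jump_kernel_nonneg[OF cm] ennreal_leI)
      qed
    qed
  qed
  also have "\<dots> = ennreal (2 * ?M) * emeasure (levy_measure \<mu>) (- ?B)
      + ennreal (L x) * levy_moment TYPE('a) \<mu> (R x)"
    unfolding levy_measure_compl_ball[OF cm R] levy_moment_eq
    by (subst nn_integral_add, measurable, simp only: nn_integral_cmult[OF tail_meas] nn_integral_cmult[OF ball_meas])
  also have "\<dots> = ennreal (2 * ?M * a + L x * b)"
    using a b M L by (simp add: ennreal_mult ennreal_plus)
  \<comment> \<open>If the integrand is not integrable, its Bochner integral is \<open>0\<close>, below the nonnegative bound.\<close>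
  finally have "(LINT h|lebesgue. second_diff \<phi> h x * ?j h) \<le> 2 * ?M * a + L x * b"
    using a b M L by (intro integral_real_bounded) auto
  then have "V x \<le> 1 / (2 * \<phi> x) * (2 * ?M * a + L x * b)"
    unfolding V using pos by (intro mult_left_mono) auto
  also have "\<dots> = ?M / \<phi> x * a + L x / (2 * \<phi> x) * b"
    using pos by (simp add: field_simps)
  also have "\<dots> \<le> 2 * ?M / \<phi> x * a + L x / (2 * \<phi> x) * b"
    using pos M a(1) by (intro add_right_mono mult_right_mono divide_right_mono) auto
  finally show ?thesis
    using a b by (simp add: enn2ereal_ennreal)
qed

end
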